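(* Consider the $[pqrs]$ random walk on $\{0,1,\dots,N\}$ described in the context. For $i=0,1,\dots,N$, the expected time $m_i$ before absorption when starting in $i$ is $$m_i=\frac{1-s}{s}+\frac{\left(1-\frac{s_0}{s}\right)\left[w_1\xi_2^{N-i-1}-w_2\xi_1^{N-i-1}\right]+\left(1-\frac{s_N}{s}\right)\left(\frac pq\right)^{N-2}\left[v_1\xi_2^{1-i}-v_2\xi_1^{1-i}\right]}{v_1w_2\xi_1^{N-2}-v_2w_1\xi_2^{N-2}} .$$
   Context: The walk: let $p,q,r,s$ be probabilities with $p+q+r+s=1$ and $pqs>0$. In each state $n\in\{1,\dots,N-1\}$, at each time step the particle moves to $n+1$ with probability $p$, moves to $n-1$ with probability $q$, stays in $n$ with probability $r$, or is absorbed in $n$ (removed) with probability $s$. In state $0$ it moves to $1$ with probability $p_0$, stays with probability $r_0$, is absorbed with probability $s_0$, where $p_0+r_0+s_0=1$. In state $N$ it moves to $N-1$ with probability $q_N$, stays with probability $r_N$, is absorbed with probability $s_N$, where $q_N+r_N+s_N=1$. The time before absorption is the number of steps (forward, backward, or staying) made before the absorption; the absorption event itself is not counted as a step. Thus $(1-r_0)m_0=p_0m_1+1-s_0$, $(1-r)m_i=p\,m_{i+1}+q\,m_{i-1}+1-s$ for $1\le i\le N-1$, and $(1-r_N)m_N=q_Nm_{N-1}+1-s_N$. Notation: $$\xi_1=\frac{(1-r)+\sqrt{(1-r)^2-4pq}}{2q},\quad \xi_2=\frac{(1-r)-\sqrt{(1-r)^2-4pq}}{2q},$$ $$v_i=p_0-(1-r_0)\xi_i,\qquad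 w_i=q_N-(1-r_N)\xi_i^{-1}\qquad(i=1,2).$$
   Formalization: The second bracket's sign is corrected to v_2 ξ_1^{1-i} − v_1 ξ_2^{1-i} (as printed the formula fails, e.g. for N=2); it is also assumed that N≥1, r_0<1, r_N<1, and, if N=1, that s_0>0 or s_N>0, since otherwise the denominator vanishes. *)

theory Defs
  imports "HOL-Probability.Probability"
begin

(* One-step probabilities K x y = P(x -> y).  The state Some n means that the particle
   sits in n; None is a cemetery state that the particle enters when it is absorbed, in
   whichever n this happens.  The last branch is meant for 0 < n < N; it also gives junk
   values for n > N, which cannot be reached from {0..N}. *)
definition pqrs_kernel ::
  "nat \<Rightarrow> real \<Rightarrow> real \<Rightarrow> real \<Rightarrow> real \<Rightarrow> real \<Rightarrow> real \<Rightarrow> real \<Rightarrow> real \<Rightarrow> real \<Rightarrow> real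
    \<Rightarrow> nat option \<Rightarrow> nat option \<Rightarrow> real"
where
  "pqrs_kernel N p q r s p\<^sub>0 r\<^sub>0 s\<^sub>0 q\<^sub>N r\<^sub>N s\<^sub>N x y =
    (case x of
       None \<Rightarrow> (if y = None then 1 else 0)
     | Some n \<Rightarrow>
         if n = 0 then
           (if y = Some 1 then p\<^sub>0 else if y = Some 0 then r\<^sub>0
            else if y = None then s\<^sub>0 else 0)
         else if n = N then
           (if y = Some (N - 1) then q\<^sub>N else if y = Some N then r\<^sub>N
            else if y = None then s\<^sub>N else 0)
         else
           (if y = Some (n + 1) then p else if y = Some (n - 1) then q
            else if y = Some n then r else if y = None then s else 0))"

definition markov_chain_from ::
  "'w measure \<Rightarrow> ('s \<Rightarrow> 's \<Rightarrow> real) \<Rightarrow> 's \<Rightarrow> (nat \<Rightarrow> 'w \<Rightarrow> 's) \<Rightarrow> bool"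
where
  "markov_chain_from M K x X \<longleftrightarrow>
     prob_space M \<and>
     (\<forall>t. X t \<in> measurable M (count_space UNIV)) \<and>
     (AE \<omega> in M. X 0 \<omega> = x) \<and>
     (\<forall>t h y. \<P>(\<omega> in M. \<forall>k\<le>t. X k \<omega> = h k) > 0 \<longrightarrow>
        \<P>(\<omega> in M. X (Suc t) \<omega> = y \<bar> \<forall>k\<le>t. X k \<omega> = h k) = K (h t) y)"

(* If the first visit to None happens at time t + 1, then t steps precede it, because the
   absorption itself is not counted. *)
definition time_before_absorption :: "(nat \<Rightarrow> 'w \<Rightarrow> 'a option) \<Rightarrow> 'w \<Rightarrow> enat"
where
  "time_before_absorption X \<omega> =
     (if \<exists>t. X (Suc t) \<omega> = None then enat (LEAST t. X (Suc t) \<omega> = None) else \<infinity>)"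

definition expected_time_before_absorption ::
  "'w measure \<Rightarrow> (nat \<Rightarrow> 'w \<Rightarrow> 'a option) \<Rightarrow> ennreal"
where
  "expected_time_before_absorption M X =
     (\<integral>\<^sup>+ \<omega>. ennreal_of_enat (time_before_absorption X \<omega>) \<partial>M)"

end

theory Submission
  imports Defs
begin

text \<open>
  Let \<open>P\<close> be the transition matrix restricted to the live states \<open>0, ..., N\<close>, a substochastic
  matrix, and let \<open>\<sigma> x\<close> be the probability of absorption in \<open>x\<close>. Conditioning on the first step
  suggests that the expected time \<open>m\<close> solves \<open>m = P m + (1 - \<sigma>)\<close>. The proof runs in the opposite
  direction: it exhibits a finite solution \<open>m\<close> of this linear system and deduces that \<open>m\<close> is the
  expected time.

  The second half of this is a telescoping argument (lemma \<open>first_step_analysis\<close>). Writing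
  \<open>u\<^sub>t\<close> for the law of the walk on the live states at time \<open>t\<close> and \<open>a\<^sub>t\<close> for the expectation of
  \<open>m\<close> under \<open>u\<^sub>t\<close>, the system says that \<open>a\<^sub>t - a\<^sub>t\<^sub>+\<^sub>1\<close> is the probability of being alive at time
  \<open>t + 1\<close>. The time before absorption is the number of \<open>t\<close> for which the walk is alive at time
  \<open>t + 1\<close>, so its mean is the sum of these probabilities, that is \<open>a\<^sub>0 - lim a\<^sub>t\<close>. Since \<open>m\<close> is
  bounded, so are the partial sums; hence the survival probabilities tend to 0, and \<open>a\<^sub>t\<close> with
  them. Thus almost sure absorption and finiteness of the mean both come from the mere
  existence of a solution.

  For the first half, \<open>m = (1 - s) / s\<close> solves the interior equations, and the excess
  \<open>d = m - (1 - s) / s\<close> solves a homogeneous recurrence whose characteristic roots are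
  \<open>1 / \<xi>\<^sub>1\<close> and \<open>1 / \<xi>\<^sub>2\<close>. The two boundary equations fix the two coefficients, by Cramer's rule
  (lemma \<open>excess_boundary_problem\<close>), as long as the determinant, which up to a power of
  \<open>\<xi>\<^sub>1 \<xi>\<^sub>2\<close> is the denominator of the formula, is not 0. The latter is in fact positive (lemma
  \<open>denominator_pos\<close>): since
  \<open>0 < \<xi>\<^sub>2 < 1 < \<xi>\<^sub>1\<close>, it can be expanded into terms of which none is negative.
\<close>

section \<open>Markov chains with a cemetery state\<close>

text \<open>
  The Markov property is given for complete histories. There are only countably many
  histories up to time \<open>t\<close> when the state space is countable, so summing over those that
  end in \<open>x\<close> leaves the usual one-step property. The sum is taken
  in the extended nonnegative reals, and a factor \<open>K x y\<close> can be pulled out of it because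
  \<open>K x y\<close> is a conditional probability, hence nonnegative, as soon as \<open>x\<close> is visited with
  positive probability.
\<close>

lemma markov_chain_joint:
  fixes X :: "nat \<Rightarrow> 'w \<Rightarrow> 's::countable"
  assumes mc: "markov_chain_from M K z X"
  shows "measure M {\<omega>\<in>space M. X t \<omega> = x \<and> X (Suc t) \<omega> = y}
       = measure M {\<omega>\<in>space M. X t \<omega> = x} * K x y"
proof -
  interpret prob_space M using mc by (simp add: markov_chain_from_def)
  have [measurable]: "X k \<in> measurable M (count_space UNIV)" for k
    using mc by (simp add: markov_chain_from_def)
  define C where "C h = {\<omega>\<in>space M. \<forall>k\<le>t. X k \<omega> = h k}" for h
  define H where "H = {h \<in> PiE {..t} (\<lambda>_. UNIV). h t = x}"
  have cH: "countable H" unfolding H_def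
    by (rule countable_subset[OF _ countable_PiE[of "{..t}" "\<lambda>_. UNIV :: 's set"]]) auto
  have C_sets [measurable]: "C h \<in> sets M" for h unfolding C_def by measurable
  have step: "measure M (C h \<inter> {\<omega>\<in>space M. X (Suc t) \<omega> = y}) = measure M (C h) * K x y"
    if "h \<in> H" for h
  proof (cases "measure M (C h) > 0")
    case True
    then have "\<P>(\<omega> in M. X (Suc t) \<omega> = y \<bar> \<forall>k\<le>t. X k \<omega> = h k) = K (h t) y"
      using mc by (simp add: markov_chain_from_def C_def)
    moreover have "{\<omega>\<in>space M. X (Suc t) \<omega> = y \<and> (\<forall>k\<le>t. X k \<omega> = h k)}
        = C h \<inter> {\<omega>\<in>space M. X (Suc t) \<omega> = y}" by (auto simp: C_def)
    ultimately show ?thesis using True that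
      by (simp add: cond_prob_def H_def C_def[symmetric] field_simps)
  next
    case False
    then have "measure M (C h) = 0" by (simp add: zero_less_measure_iff)
    moreover have "measure M (C h \<inter> {\<omega>\<in>space M. X (Suc t) \<omega> = y}) \<le> measure M (C h)"
      by (intro finite_measure_mono) auto
    ultimately show ?thesis by (simp add: measure_le_0_iff)
  qed
  have disj: "disjoint_family_on (\<lambda>h. C h \<inter> B) H" for B
  proof (unfold disjoint_family_on_def, intro ballI impI)
    fix g h assume gh: "g \<in> H" "h \<in> H" "g \<noteq> h"
    then obtain k where "k \<le> t" "g k \<noteq> h k"
      unfolding H_def by (metis (mono_tags, lifting) PiE_ext atMost_iff mem_Collect_eq)
    then show "C g \<inter> B \<inter> (C h \<inter> B) = {}" by (auto simp: C_def)
  qed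
  have cover: "{\<omega>\<in>space M. X t \<omega> = x} = (\<Union>h\<in>H. C h)"
  proof (intro equalityI subsetI)
    fix \<omega> assume "\<omega> \<in> {\<omega>\<in>space M. X t \<omega> = x}"
    then have "restrict (\<lambda>k. X k \<omega>) {..t} \<in> H" "\<omega> \<in> C (restrict (\<lambda>k. X k \<omega>) {..t})"
      by (auto simp: H_def C_def)
    then show "\<omega> \<in> (\<Union>h\<in>H. C h)" by blast
  qed (auto simp: H_def C_def)
  have sum: "emeasure M ((\<Union>h\<in>H. C h) \<inter> B) = (\<integral>\<^sup>+h. emeasure M (C h \<inter> B) \<partial>count_space H)"
    if "B \<in> sets M" for B
    using emeasure_UN_countable[OF _ cH disj[of B]] that by (simp add: Int_UN_distrib2)
  let ?A = "{\<omega>\<in>space M. X t \<omega> = x}" and ?B = "{\<omega>\<in>space M. X (Suc t) \<omega> = y}"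
  have AB: "{\<omega>\<in>space M. X t \<omega> = x \<and> X (Suc t) \<omega> = y} = ?A \<inter> ?B" by auto
  have sumA: "emeasure M ?A = (\<integral>\<^sup>+h. emeasure M (C h) \<partial>count_space H)"
  proof -
    have "C h \<inter> space M = C h" "(\<Union>h\<in>H. C h) \<inter> space M = (\<Union>h\<in>H. C h)" for h
      by (auto simp: C_def)
    then show ?thesis using sum[of "space M"] unfolding cover by simp
  qed
  show ?thesis
  proof (cases "measure M ?A = 0")
    case True
    moreover have "measure M (?A \<inter> ?B) \<le> measure M ?A" by (intro finite_measure_mono) auto
    ultimately show ?thesis unfolding AB by (simp add: measure_le_0_iff)
  next
    case False
    then have "(\<integral>\<^sup>+h. emeasure M (C h) \<partial>count_space H) \<noteq> (\<integral>\<^sup>+h. 0 \<partial>count_space H)"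
      unfolding sumA[symmetric] by (simp add: emeasure_eq_measure)
    then obtain h where h: "h \<in> H" "measure M (C h) > 0"
      by (metis (mono_tags, lifting) emeasure_eq_measure ennreal_0 nn_integral_cong
          space_count_space zero_less_measure_iff)
    have "0 \<le> measure M (C h) * K x y" unfolding step[OF h(1), symmetric] by simp
    with h have K: "0 \<le> K x y" by (simp add: zero_le_mult_iff)
    have "emeasure M (?A \<inter> ?B) = (\<integral>\<^sup>+h. emeasure M (C h) * ennreal (K x y) \<partial>count_space H)"
      unfolding cover sum[of ?B, simplified]
      by (intro nn_integral_cong) (simp add: emeasure_eq_measure step K ennreal_mult'')
    also have "\<dots> = emeasure M ?A * ennreal (K x y)"
      unfolding sumA by (rule nn_integral_multc) simp
    finally show ?thesis unfolding AB using K
      by (simp add: emeasure_eq_measure ennreal_mult''[symmetric])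
  qed
qed

text \<open>
  Once absorbed, the walk stays absorbed, so the first hitting time of the cemetery is the
  number of times at which the walk is still alive. Dropping time 0 from this count leaves the
  absorbing step uncounted.
\<close>

lemma time_before_absorption_eq_suminf:
  assumes absorbing: "\<And>t. X t \<omega> = None \<Longrightarrow> X (Suc t) \<omega> = None"
  shows "ennreal_of_enat (time_before_absorption X \<omega>)
       = (\<Sum>t. indicator {\<omega>. X (Suc t) \<omega> \<noteq> None} \<omega>)"
proof -
  let ?A = "{t. X (Suc t) \<omega> \<noteq> None}"
  have "(\<Sum>t. indicator {\<omega>. X (Suc t) \<omega> \<noteq> None} \<omega>) = (\<Sum>t. indicator ?A t :: ennreal)"
    by (simp add: indicator_def)
  also have "\<dots> = emeasure (count_space UNIV) ?A"
    by (simp flip: nn_integral_count_space_nat)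
  also have "\<dots> = ennreal_of_enat (time_before_absorption X \<omega>)"
  proof (cases "\<exists>t. X (Suc t) \<omega> = None")
    case False
    then have "?A = UNIV" by auto
    with False show ?thesis by (simp add: time_before_absorption_def)
  next
    case True
    define n where "n = (LEAST t. X (Suc t) \<omega> = None)"
    have n: "X (Suc n) \<omega> = None" unfolding n_def using True by (rule LeastI_ex)
    have "X (Suc (n + k)) \<omega> = None" for k
      by (induction k) (use n absorbing in auto)
    then have "t \<notin> ?A" if "n \<le> t" for t using that by (auto simp: le_iff_add)
    moreover have "t \<in> ?A" if "t < n" for t using not_less_Least[of t] that by (auto simp: n_def)
    ultimately have "?A = {..<n}" by (auto simp: not_le[symmetric])
    with True show ?thesis by (simp add: time_before_absorption_def n_def ennreal_of_nat_eq_real_of_nat)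
  qed
  finally show ?thesis by simp
qed

text \<open>
  A real solution \<open>m\<close> of the first-step equations on a finite set of live states is
  necessarily the expected time before absorption. The summands in the mean telescope along
  \<open>a t\<close>, the expectation of \<open>m\<close> at time \<open>t\<close> over the surviving paths, and boundedness of \<open>m\<close>
  forces \<open>a t\<close> to vanish in the limit.
\<close>

lemma first_step_analysis:
  fixes X :: "nat \<Rightarrow> 'w \<Rightarrow> 's::countable option" and m :: "'s \<Rightarrow> real"
  assumes mc: "markov_chain_from M K (Some i) X"
    and S: "finite S" "i \<in> S"
    and cemetery: "\<And>y. K None y = (if y = None then 1 else 0)"
    and row: "\<And>x. x \<in> S \<Longrightarrow> (\<Sum>y\<in>S. K (Some x) (Some y)) + K (Some x) None = 1"
    and m: "\<And>x. x \<in> S \<Longrightarrow> m x = (\<Sum>y\<in>S. K (Some x) (Some y) * m y) + (1 - K (Some x) None)"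
  shows "enn2ereal (expected_time_before_absorption M X) = ereal (m i)"
proof -
  interpret prob_space M using mc by (simp add: markov_chain_from_def)
  have [measurable]: "X k \<in> measurable M (count_space UNIV)" for k
    using mc by (simp add: markov_chain_from_def)
  have X0: "AE \<omega> in M. X 0 \<omega> = Some i" using mc by (simp add: markov_chain_from_def)
  note joint = markov_chain_joint[OF mc]
  define u where "u t x = measure M {\<omega>\<in>space M. X t \<omega> = x}" for t x
  define L where "L = insert None (Some ` S)"
  have sumL: "(\<Sum>x\<in>L. f x) = f None + (\<Sum>x\<in>S. f (Some x))" for f :: "'s option \<Rightarrow> real"
    unfolding L_def using S by (simp add: sum.reindex)
  have finL: "finite L" using S by (simp add: L_def)
  have part: "measure M {\<omega>\<in>space M. X t \<omega> \<in> L \<and> X k \<omega> \<in> B}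
      = (\<Sum>x\<in>L. measure M {\<omega>\<in>space M. X t \<omega> = x \<and> X k \<omega> \<in> B})" for t k B
  proof -
    have "{\<omega>\<in>space M. X t \<omega> \<in> L \<and> X k \<omega> \<in> B} = (\<Union>x\<in>L. {\<omega>\<in>space M. X t \<omega> = x \<and> X k \<omega> \<in> B})"
      by auto
    also have "measure M \<dots> = (\<Sum>x\<in>L. measure M {\<omega>\<in>space M. X t \<omega> = x \<and> X k \<omega> \<in> B})"
      by (intro finite_measure_finite_Union finL)
         (auto simp: disjoint_family_on_def image_subset_iff)
    finally show ?thesis .
  qed
  have step: "u (Suc t) y = (\<Sum>x\<in>L. u t x * K x y)" if "AE \<omega> in M. X t \<omega> \<in> L" for t y
  proof -
    have "u (Suc t) y = measure M {\<omega>\<in>space M. X t \<omega> \<in> L \<and> X (Suc t) \<omega> \<in> {y}}"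
      unfolding u_def by (rule finite_measure_eq_AE) (use that in auto)
    also have "\<dots> = (\<Sum>x\<in>L. u t x * K x y)"
      unfolding part u_def joint[symmetric] by simp
    finally show ?thesis .
  qed
  have AE_iff: "(AE \<omega> in M. X t \<omega> \<in> L) \<longleftrightarrow> (\<Sum>x\<in>L. u t x) = 1" for t
    using part[of t t UNIV] by (simp add: u_def prob_Collect_eq_1[symmetric])
  have confined: "AE \<omega> in M. X t \<omega> \<in> L" for t
  proof (induction t)
    case 0
    show ?case using X0 by eventually_elim (use S in \<open>auto simp: L_def\<close>)
  next
    case (Suc t)
    have rowL: "(\<Sum>y\<in>L. K x y) = 1" if "x \<in> L" for x
      using that row by (auto simp: sumL cemetery) (auto simp: L_def cemetery add.commute)
    have "(\<Sum>y\<in>L. u (Suc t) y) = (\<Sum>x\<in>L. u t x * (\<Sum>y\<in>L. K x y))"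
      unfolding step[OF Suc] sum_distrib_left by (rule sum.swap)
    also have "\<dots> = 1" using Suc rowL by (simp add: AE_iff)
    finally show ?case by (simp add: AE_iff)
  qed
  have evol: "u (Suc t) (Some y) = (\<Sum>x\<in>S. u t (Some x) * K (Some x) (Some y))" for t y
    unfolding step[OF confined] by (simp add: sumL cemetery)
  define alive where "alive t = (\<Sum>x\<in>S. u t (Some x))" for t
  define a where "a t = (\<Sum>x\<in>S. u t (Some x) * m x)" for t
  have u0: "0 \<le> u t x" for t x by (simp add: u_def)
  have alive_eq: "measure M {\<omega>\<in>space M. X t \<omega> \<noteq> None} = alive t" for t
  proof -
    have "measure M {\<omega>\<in>space M. X t \<omega> \<noteq> None} = 1 - u t None"
      unfolding u_def by (rule prob_neg) measurable
    then show ?thesis using confined[of t] unfolding AE_iff by (simp add: sumL alive_def)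
  qed
  have alive01: "0 \<le> alive t" "alive t \<le> 1" for t
    unfolding alive_eq[symmetric] by auto
  have drift: "alive (Suc t) = a t - a (Suc t)" for t
  proof -
    have "a (Suc t) = (\<Sum>x\<in>S. u t (Some x) * (\<Sum>y\<in>S. K (Some x) (Some y) * m y))"
      unfolding a_def evol sum_distrib_left sum_distrib_right
      by (subst sum.swap) (simp add: mult.assoc)
    also have "\<dots> = (\<Sum>x\<in>S. u t (Some x) * m x - u t (Some x) * (1 - K (Some x) None))"
      by (intro sum.cong refl) (simp add: m algebra_simps)
    also have "\<dots> = a t - (\<Sum>x\<in>S. u t (Some x) * (1 - K (Some x) None))"
      by (simp add: a_def sum_subtractf)
    also have "(\<Sum>x\<in>S. u t (Some x) * (1 - K (Some x) None))
        = (\<Sum>x\<in>S. u t (Some x) * (\<Sum>y\<in>S. K (Some x) (Some y)))"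
      by (intro sum.cong refl) (metis add_diff_cancel_right' row)
    also have "\<dots> = alive (Suc t)"
      unfolding alive_def evol sum_distrib_left by (rule sum.swap)
    finally show ?thesis by simp
  qed
  have partial: "(\<Sum>t<k. alive (Suc t)) = a 0 - a k" for k
    unfolding drift by (rule sum_lessThan_telescope')
  define c where "c = (\<Sum>x\<in>S. \<bar>m x\<bar>)"
  have a_bound: "\<bar>a t\<bar> \<le> alive t * c" for t
  proof -
    have "\<bar>a t\<bar> \<le> (\<Sum>x\<in>S. u t (Some x) * \<bar>m x\<bar>)"
      unfolding a_def by (rule order.trans[OF sum_abs]) (simp add: abs_mult u0)
    also have "\<dots> \<le> (\<Sum>x\<in>S. u t (Some x) * c)"
      unfolding c_def using S by (intro sum_mono mult_left_mono member_le_sum) (auto simp: u0)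
    finally show ?thesis by (simp add: alive_def sum_distrib_right)
  qed
  have c0: "0 \<le> c" by (simp add: c_def sum_nonneg)
  \<comment> \<open>A first use of the bound, with survival probabilities at most 1, makes the series
    converge; its terms then tend to 0, and a second use sends a to 0.\<close>
  have "(\<Sum>t<k. alive (Suc t)) \<le> \<bar>a 0\<bar> + c" for k
    using a_bound[of k] mult_right_mono[OF alive01(2)[of k] c0] unfolding partial by linarith
  then have "summable (\<lambda>t. alive (Suc t))"
    using alive01 by (intro summableI_nonneg_bounded)
  then have "(\<lambda>t. alive (Suc t)) \<longlonglongrightarrow> 0" by (rule summable_LIMSEQ_zero)
  then have "alive \<longlonglongrightarrow> 0" by (simp add: filterlim_sequentially_Suc)
  moreover have "\<forall>\<^sub>F t in sequentially. norm (a t) \<le> norm (alive t) * c"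
    by (rule always_eventually, rule allI) (simp only: real_norm_def abs_of_nonneg[OF alive01(1)] a_bound)
  ultimately have "a \<longlonglongrightarrow> 0" by (rule tendsto_0_le)
  then have "(\<lambda>k. a 0 - a k) \<longlonglongrightarrow> a 0 - 0" by (intro tendsto_intros)
  then have sums: "(\<lambda>t. alive (Suc t)) sums a 0" by (simp add: sums_def partial)
  have "u 0 (Some x) = (if x = i then 1 else 0)" for x
  proof -
    have "u 0 (Some x) = measure M {\<omega>\<in>space M. x = i}"
      unfolding u_def by (rule finite_measure_eq_AE) (use X0 in auto)
    then show ?thesis by (simp add: prob_space)
  qed
  then have "a 0 = (\<Sum>x\<in>S. if x = i then m x else 0)"
    unfolding a_def by (intro sum.cong refl) simp
  then have a0: "a 0 = m i" using S by simp
  have absorbing: "AE \<omega> in M. \<forall>t. X t \<omega> = None \<longrightarrow> X (Suc t) \<omega> = None"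
  proof -
    have "AE \<omega> in M. \<not> (X t \<omega> = None \<and> X (Suc t) \<omega> = Some y)" for t y
      by (subst prob_Collect_eq_0[symmetric]) (simp_all add: joint cemetery)
    then have "AE \<omega> in M. \<forall>t y. \<not> (X t \<omega> = None \<and> X (Suc t) \<omega> = Some y)"
      unfolding AE_all_countable by blast
    then show ?thesis by eventually_elim (metis not_None_eq)
  qed
  have "expected_time_before_absorption M X
      = (\<integral>\<^sup>+\<omega>. (\<Sum>t. indicator {\<omega>. X (Suc t) \<omega> \<noteq> None} \<omega>) \<partial>M)"
    unfolding expected_time_before_absorption_def
    by (rule nn_integral_cong_AE, use absorbing in eventually_elim)
       (rule time_before_absorption_eq_suminf, blast)
  also have "\<dots> = (\<integral>\<^sup>+\<omega>. (\<Sum>t. indicator {\<omega>\<in>space M. X (Suc t) \<omega> \<noteq> None} \<omega>) \<partial>M)"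
    by (intro nn_integral_cong) (simp add: indicator_def)
  also have "\<dots> = (\<Sum>t. emeasure M {\<omega>\<in>space M. X (Suc t) \<omega> \<noteq> None})"
    by (subst nn_integral_suminf) (simp_all add: nn_integral_indicator)
  also have "\<dots> = (\<Sum>t. ennreal (alive (Suc t)))"
    unfolding emeasure_eq_measure alive_eq ..
  also have "\<dots> = ennreal (a 0)"
    by (rule suminf_ennreal_eq[OF _ sums]) (rule alive01)
  finally have "expected_time_before_absorption M X = ennreal (m i)" by (simp add: a0)
  moreover have "0 \<le> m i"
    using sums_le[OF _ sums_zero sums] alive01 by (simp add: a0)
  ultimately show ?thesis by simp
qed

section \<open>The homogeneous recurrence and its boundary conditions\<close>

text \<open>
  The \<open>\<xi>\<^sub>i\<close> are the roots of \<open>q \<xi>\<^sup>2 - (1 - r) \<xi> + p\<close>. This polynomial takes the values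
  \<open>p > 0\<close> at 0 and \<open>-s < 0\<close> at 1, so 1 lies strictly between two positive real roots.
\<close>

lemma quadratic_roots_separated:
  fixes p q r s :: real
  assumes "p > 0" "q > 0" "s > 0" and sum: "p + q + r + s = 1"
    and \<xi>\<^sub>1: "\<xi>\<^sub>1 = ((1 - r) + sqrt ((1 - r)^2 - 4 * p * q)) / (2 * q)"
    and \<xi>\<^sub>2: "\<xi>\<^sub>2 = ((1 - r) - sqrt ((1 - r)^2 - 4 * p * q)) / (2 * q)"
  shows "0 < \<xi>\<^sub>2" "\<xi>\<^sub>2 < 1" "1 < \<xi>\<^sub>1"
    and "(1 - r) * \<xi>\<^sub>1 = p + q * \<xi>\<^sub>1\<^sup>2" "(1 - r) * \<xi>\<^sub>2 = p + q * \<xi>\<^sub>2\<^sup>2" "p / q = \<xi>\<^sub>1 * \<xi>\<^sub>2"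
proof -
  define e where "e = sqrt ((1 - r)^2 - 4 * p * q)"
  have r: "1 - r = p + q + s" using sum by simp
  have disc: "(1 - r)^2 - 4 * p * q = (p - q)^2 + s * (2 * p + 2 * q + s)"
    unfolding r by algebra
  have gt: "(p - q)^2 < (1 - r)^2 - 4 * p * q"
    unfolding disc using assms by simp
  then have e2: "e^2 = (1 - r)^2 - 4 * p * q"
    unfolding e_def using zero_le_power2[of "p - q"] by (intro real_sqrt_pow2) linarith
  have e0: "0 \<le> e" using gt zero_le_power2[of "p - q"] unfolding e_def by (intro real_sqrt_ge_zero) linarith
  \<comment> \<open>The differences are 4 q s and 4 p s; the inequalities put 1 between the roots.\<close>
  have "(p - q + s)\<^sup>2 < e\<^sup>2"  "(q - p + s)\<^sup>2 < e\<^sup>2"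
    unfolding e2 r using assms by (auto simp: power2_eq_square algebra_simps)
  then have b: "p - q + s < e" "q - p + s < e" using e0 by (auto intro: power2_less_imp_less)
  have "e\<^sup>2 < (1 - r)\<^sup>2" unfolding e2 using assms by simp
  then have c: "e < 1 - r" by (rule power2_less_imp_less) (use r assms in simp)
  have x1: "\<xi>\<^sub>1 = (p + q + s + e) / (2 * q)" and x2: "\<xi>\<^sub>2 = (p + q + s - e) / (2 * q)"
    by (simp_all add: \<xi>\<^sub>1 \<xi>\<^sub>2 r e_def)
  show "0 < \<xi>\<^sub>2" "\<xi>\<^sub>2 < 1" "1 < \<xi>\<^sub>1"
    unfolding x1 x2 using b c r assms by (auto simp: field_simps)
  have e2': "e^2 = (p + q + s)^2 - 4 * p * q" using e2 r by simp
  show "p / q = \<xi>\<^sub>1 * \<xi>\<^sub>2"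
    unfolding x1 x2 using e2' \<open>q > 0\<close> by (simp add: field_simps power2_eq_square)
  have root: "(1 - r) * \<xi> = p + q * \<xi>\<^sup>2" if "(2 * q * \<xi> - (p + q + s))\<^sup>2 = e\<^sup>2" for \<xi>
  proof -
    have "4 * q * ((1 - r) * \<xi>) = 4 * q * (p + q * \<xi>\<^sup>2)"
      unfolding r using that[unfolded e2'] by algebra
    then show ?thesis using \<open>q > 0\<close> by simp
  qed
  have lin: "2 * q * \<xi>\<^sub>1 = p + q + s + e" "2 * q * \<xi>\<^sub>2 = p + q + s - e"
    unfolding x1 x2 using \<open>q > 0\<close> by simp_all
  show "(1 - r) * \<xi>\<^sub>1 = p + q * \<xi>\<^sub>1\<^sup>2" "(1 - r) * \<xi>\<^sub>2 = p + q * \<xi>\<^sub>2\<^sup>2"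
    using root[of \<xi>\<^sub>1] root[of \<xi>\<^sub>2] lin by simp_all
qed

text \<open>
  Put \<open>\<alpha> = \<xi>\<^sub>1 - 1\<close> and \<open>\<beta> = 1 - \<xi>\<^sub>2\<close>, both positive, and \<open>k = N - 1\<close>. Then
  \<open>(1 - r\<^sub>0) \<xi>\<^sub>1 - p\<^sub>0 = p\<^sub>0 \<alpha> + s\<^sub>0 \<xi>\<^sub>1\<close>, and similarly for the other three factors. Multiplying out,
  the denominator times \<open>\<xi>\<^sub>1 \<xi>\<^sub>2\<close> is a combination of \<open>p\<^sub>0 q\<^sub>N\<close>, \<open>p\<^sub>0 s\<^sub>N\<close>, \<open>s\<^sub>0 q\<^sub>N\<close> and \<open>s\<^sub>0 s\<^sub>N\<close> with
  nonnegative coefficients. Only the coefficient of \<open>p\<^sub>0 q\<^sub>N\<close> can vanish, and it does so exactly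
  when \<open>N = 1\<close>. This is why \<open>N = 1\<close> requires a positive \<open>s\<^sub>0\<close> or \<open>s\<^sub>N\<close>: a walk on two states
  without absorption lives forever.
\<close>

lemma denominator_pos:
  fixes \<xi>\<^sub>1 \<xi>\<^sub>2 :: real
  assumes N: "N \<ge> 1" and \<xi>: "0 < \<xi>\<^sub>2" "\<xi>\<^sub>2 < 1" "1 < \<xi>\<^sub>1"
    and left: "p\<^sub>0 \<ge> 0" "s\<^sub>0 \<ge> 0" "p\<^sub>0 + r\<^sub>0 + s\<^sub>0 = 1" "r\<^sub>0 < 1"
    and right: "q\<^sub>N \<ge> 0" "s\<^sub>N \<ge> 0" "q\<^sub>N + r\<^sub>N + s\<^sub>N = 1" "r\<^sub>N < 1"
    and nd: "N = 1 \<Longrightarrow> s\<^sub>0 > 0 \<or> s\<^sub>N > 0"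
  shows "0 < (p\<^sub>0 - (1 - r\<^sub>0) * \<xi>\<^sub>1) * (q\<^sub>N - (1 - r\<^sub>N) * inverse \<xi>\<^sub>2) * \<xi>\<^sub>1 powi (int N - 2)
           - (p\<^sub>0 - (1 - r\<^sub>0) * \<xi>\<^sub>2) * (q\<^sub>N - (1 - r\<^sub>N) * inverse \<xi>\<^sub>1) * \<xi>\<^sub>2 powi (int N - 2)"
    (is "0 < ?D")
proof -
  obtain k where k: "N = Suc k" using N by (cases N) auto
  define \<alpha> \<beta> where "\<alpha> = \<xi>\<^sub>1 - 1" and "\<beta> = 1 - \<xi>\<^sub>2"
  have pos: "\<alpha> > 0" "\<beta> > 0" using \<xi> by (auto simp: \<alpha>_def \<beta>_def)
  have r: "1 - r\<^sub>0 = p\<^sub>0 + s\<^sub>0" "1 - r\<^sub>N = q\<^sub>N + s\<^sub>N" using left right by auto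
  have pw: "\<xi> powi (int N - 2) = \<xi> ^ k / \<xi>" if "\<xi> \<noteq> 0" for \<xi> :: real
  proof -
    have "int N - 2 = int k - 1" using k by simp
    then show ?thesis using that by (simp add: power_int_diff del: of_nat_Suc)
  qed
  define A B C E where "A = \<alpha> * \<beta> * (\<xi>\<^sub>1 ^ k - \<xi>\<^sub>2 ^ k)" and "B = \<alpha> * \<xi>\<^sub>1 ^ k + \<beta> * \<xi>\<^sub>2 ^ k"
    and "C = \<beta> * \<xi>\<^sub>1 ^ Suc k + \<alpha> * \<xi>\<^sub>2 ^ Suc k" and "E = \<xi>\<^sub>1 ^ Suc k - \<xi>\<^sub>2 ^ Suc k"
  have D: "\<xi>\<^sub>1 * \<xi>\<^sub>2 * ?D = p\<^sub>0 * q\<^sub>N * A + p\<^sub>0 * s\<^sub>N * B + s\<^sub>0 * q\<^sub>N * C + s\<^sub>0 * s\<^sub>N * E"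
    unfolding r using \<xi>
    by (simp add: pw A_def B_def C_def E_def \<alpha>_def \<beta>_def field_simps)
  have BCE: "B > 0" "C > 0" "E > 0"
    using pos \<xi> by (auto simp: B_def C_def E_def simp del: power_Suc intro!: add_pos_pos power_strict_mono)
  have A0: "A \<ge> 0" unfolding A_def using pos \<xi> by (auto intro!: mult_nonneg_nonneg power_mono)
  have A: "A > 0" if "k \<noteq> 0"
    unfolding A_def using pos \<xi> that by (auto intro!: mult_pos_pos power_strict_mono)
  have nn: "0 \<le> p\<^sub>0 * q\<^sub>N * A" "0 \<le> p\<^sub>0 * s\<^sub>N * B" "0 \<le> s\<^sub>0 * q\<^sub>N * C" "0 \<le> s\<^sub>0 * s\<^sub>N * E"
    using left right BCE A0 by auto
  have esc: "p\<^sub>0 > 0 \<or> s\<^sub>0 > 0" "q\<^sub>N > 0 \<or> s\<^sub>N > 0" using left right by auto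
  have "0 < p\<^sub>0 * q\<^sub>N * A \<or> 0 < p\<^sub>0 * s\<^sub>N * B \<or> 0 < s\<^sub>0 * q\<^sub>N * C \<or> 0 < s\<^sub>0 * s\<^sub>N * E"
  proof (cases "s\<^sub>0 > 0 \<or> s\<^sub>N > 0")
    case True then show ?thesis using esc BCE by (auto intro: mult_pos_pos)
  next
    case False then show ?thesis using esc A nd k by (auto intro: mult_pos_pos)
  qed
  then have "0 < \<xi>\<^sub>1 * \<xi>\<^sub>2 * ?D" unfolding D using nn by linarith
  moreover have "0 < \<xi>\<^sub>1 * \<xi>\<^sub>2" using \<xi> by simp
  ultimately show ?thesis by (simp only: zero_less_mult_pos)
qed

text \<open>
  The closed form is a combination of \<open>\<xi>\<^sub>1\<^sup>-\<^sup>i\<close> and \<open>\<xi>\<^sub>2\<^sup>-\<^sup>i\<close>, so it satisfies the recurrence. Its part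
  with factor \<open>a\<close> is homogeneous at the right end, its part with factor \<open>b\<close> at the left end,
  and division by \<open>D\<close> normalises the value at the other end. Powers are written
  relative to \<open>\<xi>\<^sub>1 powi (N - 2)\<close> and \<open>\<xi>\<^sub>2 powi (N - 2)\<close>, which turns the boundary
  conditions into rational identities in these two quantities.
\<close>

lemma excess_boundary_problem:
  fixes \<xi>\<^sub>1 \<xi>\<^sub>2 :: real and d :: "nat \<Rightarrow> real"
  assumes N: "N \<ge> 1" and nz: "\<xi>\<^sub>1 \<noteq> 0" "\<xi>\<^sub>2 \<noteq> 0"
    and root: "(1 - r) * \<xi>\<^sub>1 = p + q * \<xi>\<^sub>1\<^sup>2" "(1 - r) * \<xi>\<^sub>2 = p + q * \<xi>\<^sub>2\<^sup>2"
    and v\<^sub>1: "v\<^sub>1 = p\<^sub>0 - (1 - r\<^sub>0) * \<xi>\<^sub>1"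
    and v\<^sub>2: "v\<^sub>2 = p\<^sub>0 - (1 - r\<^sub>0) * \<xi>\<^sub>2"
    and w\<^sub>1: "w\<^sub>1 = q\<^sub>N - (1 - r\<^sub>N) * inverse \<xi>\<^sub>1"
    and w\<^sub>2: "w\<^sub>2 = q\<^sub>N - (1 - r\<^sub>N) * inverse \<xi>\<^sub>2"
    and D: "D = v\<^sub>1 * w\<^sub>2 * \<xi>\<^sub>1 powi (int N - 2) - v\<^sub>2 * w\<^sub>1 * \<xi>\<^sub>2 powi (int N - 2)"
    and D0: "D \<noteq> 0"
    and d: "\<And>i. d i = (a * (w\<^sub>1 * \<xi>\<^sub>2 powi (int N - int i - 1) - w\<^sub>2 * \<xi>\<^sub>1 powi (int N - int i - 1))
       + b * (\<xi>\<^sub>1 * \<xi>\<^sub>2) powi (int N - 2) * (v\<^sub>2 * \<xi>\<^sub>1 powi (1 - int i) - v\<^sub>1 * \<xi>\<^sub>2 powi (1 - int i))) / D"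
  shows "\<And>i. (1 - r) * d (Suc i) = p * d (Suc (Suc i)) + q * d i"
    and "(1 - r\<^sub>0) * d 0 = p\<^sub>0 * d 1 + a"
    and "(1 - r\<^sub>N) * d N = q\<^sub>N * d (N - 1) + b"
proof -
  define e f where "e = \<xi>\<^sub>1 powi (int N - 2)" and "f = \<xi>\<^sub>2 powi (int N - 2)"
  have ef: "e \<noteq> 0" "f \<noteq> 0" using nz by (auto simp: e_def f_def)
  define A B where "A = (b * e * f * v\<^sub>2 * \<xi>\<^sub>1 - a * w\<^sub>2 * \<xi>\<^sub>1 * e) / D"
    and "B = (a * w\<^sub>1 * \<xi>\<^sub>2 * f - b * e * f * v\<^sub>1 * \<xi>\<^sub>2) / D"
  have pw: "\<xi> powi (int N - int i - 1) = \<xi> * \<xi> powi (int N - 2) / \<xi> ^ i"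
           "\<xi> powi (1 - int i) = \<xi> / \<xi> ^ i"
    if "\<xi> \<noteq> 0" for \<xi> :: real and i
  proof -
    have "int N - int i - 1 = 1 + (int N - 2) - int i" by simp
    then show "\<xi> powi (int N - int i - 1) = \<xi> * \<xi> powi (int N - 2) / \<xi> ^ i"
      using that by (simp add: power_int_diff power_int_add power2_eq_square)
    show "\<xi> powi (1 - int i) = \<xi> / \<xi> ^ i" using that by (simp add: power_int_diff)
  qed
  have dAB: "d i = A / \<xi>\<^sub>1 ^ i + B / \<xi>\<^sub>2 ^ i" for i
    unfolding d A_def B_def pw(1)[OF nz(1)] pw(1)[OF nz(2)] pw(2)[OF nz(1)] pw(2)[OF nz(2)]
      power_int_mult_distrib e_def[symmetric] f_def[symmetric]
    using nz D0 by (simp add: field_simps)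
  show "(1 - r) * d (Suc i) = p * d (Suc (Suc i)) + q * d i" for i
  proof -
    have "(1 - r) * (c / \<xi> ^ Suc i) = p * (c / \<xi> ^ Suc (Suc i)) + q * (c / \<xi> ^ i)"
      if "\<xi> \<noteq> 0" "(1 - r) * \<xi> = p + q * \<xi>\<^sup>2" for c \<xi> :: real
    proof -
      have "(1 - r) * (c / \<xi> ^ Suc i) = (1 - r) * \<xi> * (c / \<xi> ^ Suc (Suc i))"
        using that(1) by simp
      also have "\<dots> = p * (c / \<xi> ^ Suc (Suc i)) + q * (c / \<xi> ^ i)"
        unfolding that(2) using that(1) by (simp add: field_simps power2_eq_square)
      finally show ?thesis .
    qed
    from this[OF nz(1) root(1), of A] this[OF nz(2) root(2), of B]
    show ?thesis unfolding dAB by (simp add: distrib_left)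
  qed
  have "A * v\<^sub>1 / \<xi>\<^sub>1 + B * v\<^sub>2 / \<xi>\<^sub>2 = - a * (v\<^sub>1 * w\<^sub>2 * e - v\<^sub>2 * w\<^sub>1 * f) / D"
    unfolding A_def B_def using nz D0 by (simp add: field_simps)
  also have "\<dots> = - a" using D D0 by (simp add: e_def f_def)
  finally have "A * v\<^sub>1 / \<xi>\<^sub>1 + B * v\<^sub>2 / \<xi>\<^sub>2 = - a" .
  moreover have "p\<^sub>0 * d 1 - (1 - r\<^sub>0) * d 0 = A * v\<^sub>1 / \<xi>\<^sub>1 + B * v\<^sub>2 / \<xi>\<^sub>2"
    unfolding dAB v\<^sub>1 v\<^sub>2 using nz by (simp add: field_simps)
  ultimately show "(1 - r\<^sub>0) * d 0 = p\<^sub>0 * d 1 + a" by simp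
  have pN: "\<xi> ^ (N - 1) = \<xi> * \<xi> powi (int N - 2)" "\<xi> ^ N = \<xi> * (\<xi> * \<xi> powi (int N - 2))"
    if "\<xi> \<noteq> 0" for \<xi> :: real
  proof -
    show *: "\<xi> ^ N = \<xi> * (\<xi> * \<xi> powi (int N - 2))"
      using that by (simp add: power_int_diff power2_eq_square)
    have "\<xi> ^ N = \<xi> * \<xi> ^ (N - 1)" using N by (simp add: power_eq_if)
    with * show "\<xi> ^ (N - 1) = \<xi> * \<xi> powi (int N - 2)" using that by simp
  qed
  have "A * w\<^sub>1 / (\<xi>\<^sub>1 * e) + B * w\<^sub>2 / (\<xi>\<^sub>2 * f) = - b * (v\<^sub>1 * w\<^sub>2 * e - v\<^sub>2 * w\<^sub>1 * f) / D"
    unfolding A_def B_def using nz D0 ef by (simp add: field_simps)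
  also have "\<dots> = - b" using D D0 by (simp add: e_def f_def)
  finally have "A * w\<^sub>1 / (\<xi>\<^sub>1 * e) + B * w\<^sub>2 / (\<xi>\<^sub>2 * f) = - b" .
  moreover have "q\<^sub>N * d (N - 1) - (1 - r\<^sub>N) * d N = A * w\<^sub>1 / (\<xi>\<^sub>1 * e) + B * w\<^sub>2 / (\<xi>\<^sub>2 * f)"
    unfolding dAB pN[OF nz(1)] pN[OF nz(2)] e_def[symmetric] f_def[symmetric] w\<^sub>1 w\<^sub>2
    using nz ef by (simp add: field_simps)
  ultimately show "(1 - r\<^sub>N) * d N = q\<^sub>N * d (N - 1) + b" by simp
qed

section \<open>The pqrs random walk\<close>

lemma sum_pqrs_kernel:
  fixes f :: "nat \<Rightarrow> real"
  assumes "N \<ge> 1" "x \<le> N"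
  shows "(\<Sum>y\<in>{..N}. pqrs_kernel N p q r s p\<^sub>0 r\<^sub>0 s\<^sub>0 q\<^sub>N r\<^sub>N s\<^sub>N (Some x) (Some y) * f y) =
    (if x = 0 then p\<^sub>0 * f 1 + r\<^sub>0 * f 0
     else if x = N then q\<^sub>N * f (N - 1) + r\<^sub>N * f N
     else p * f (x + 1) + q * f (x - 1) + r * f x)"
proof -
  \<comment> \<open>P, Q, R are the probabilities of moving up, down and staying. At the ends the forbidden
    move has probability 0; in particular the truncation 0 - 1 = 0 does no harm.\<close>
  define P Q R where "P = (if x = 0 then p\<^sub>0 else if x = N then 0 else p)"
    and "Q = (if x = 0 then 0 else if x = N then q\<^sub>N else q)"
    and "R = (if x = 0 then r\<^sub>0 else if x = N then r\<^sub>N else r)"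
  have "pqrs_kernel N p q r s p\<^sub>0 r\<^sub>0 s\<^sub>0 q\<^sub>N r\<^sub>N s\<^sub>N (Some x) (Some y) * f y
      = (if y = x + 1 then P * f y else 0) + (if y = x - 1 then Q * f y else 0)
        + (if y = x then R * f y else 0)" for y
    using assms by (auto simp: pqrs_kernel_def P_def Q_def R_def)
  then have "(\<Sum>y\<in>{..N}. pqrs_kernel N p q r s p\<^sub>0 r\<^sub>0 s\<^sub>0 q\<^sub>N r\<^sub>N s\<^sub>N (Some x) (Some y) * f y)
      = (if x + 1 \<le> N then P * f (x + 1) else 0) + Q * f (x - 1) + R * f x"
    using assms by (simp add: sum.distrib)
  then show ?thesis using assms by (auto simp: P_def Q_def R_def)
qed

theorem theorem4:
  fixes N i :: nat
    and p q r s p\<^sub>0 r\<^sub>0 s\<^sub>0 q\<^sub>N r\<^sub>N s\<^sub>N :: real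
    and \<xi>\<^sub>1 \<xi>\<^sub>2 v\<^sub>1 v\<^sub>2 w\<^sub>1 w\<^sub>2 :: real
    and M :: "'w measure"
    and X :: "nat \<Rightarrow> 'w \<Rightarrow> nat option"
  assumes N: "N \<ge> 1"
    and interior_nonneg: "p \<ge> 0" "q \<ge> 0" "r \<ge> 0" "s \<ge> 0"
    and interior_sum: "p + q + r + s = 1"
    and pqs: "p * q * s > 0"
    and left_nonneg: "p\<^sub>0 \<ge> 0" "r\<^sub>0 \<ge> 0" "s\<^sub>0 \<ge> 0"
    and left_sum: "p\<^sub>0 + r\<^sub>0 + s\<^sub>0 = 1"
    and right_nonneg: "q\<^sub>N \<ge> 0" "r\<^sub>N \<ge> 0" "s\<^sub>N \<ge> 0"
    and right_sum: "q\<^sub>N + r\<^sub>N + s\<^sub>N = 1"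
    and nondegenerate: "r\<^sub>0 < 1" "r\<^sub>N < 1" "N = 1 \<Longrightarrow> s\<^sub>0 > 0 \<or> s\<^sub>N > 0"
    and \<xi>\<^sub>1: "\<xi>\<^sub>1 = ((1 - r) + sqrt ((1 - r)^2 - 4 * p * q)) / (2 * q)"
    and \<xi>\<^sub>2: "\<xi>\<^sub>2 = ((1 - r) - sqrt ((1 - r)^2 - 4 * p * q)) / (2 * q)"
    and v\<^sub>1: "v\<^sub>1 = p\<^sub>0 - (1 - r\<^sub>0) * \<xi>\<^sub>1"
    and v\<^sub>2: "v\<^sub>2 = p\<^sub>0 - (1 - r\<^sub>0) * \<xi>\<^sub>2"
    and w\<^sub>1: "w\<^sub>1 = q\<^sub>N - (1 - r\<^sub>N) * inverse \<xi>\<^sub>1"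
    and w\<^sub>2: "w\<^sub>2 = q\<^sub>N - (1 - r\<^sub>N) * inverse \<xi>\<^sub>2"
    and i: "i \<le> N"
    and walk: "markov_chain_from M
                 (pqrs_kernel N p q r s p\<^sub>0 r\<^sub>0 s\<^sub>0 q\<^sub>N r\<^sub>N s\<^sub>N) (Some i) X"
  shows "enn2ereal (expected_time_before_absorption M X) =
    ereal ((1 - s) / s +
      ((1 - s\<^sub>0 / s) *
         (w\<^sub>1 * \<xi>\<^sub>2 powi (int N - int i - 1) - w\<^sub>2 * \<xi>\<^sub>1 powi (int N - int i - 1)) +
       (1 - s\<^sub>N / s) * (p / q) powi (int N - 2) *
         (v\<^sub>2 * \<xi>\<^sub>1 powi (1 - int i) - v\<^sub>1 * \<xi>\<^sub>2 powi (1 - int i))) /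
      (v\<^sub>1 * w\<^sub>2 * \<xi>\<^sub>1 powi (int N - 2) - v\<^sub>2 * w\<^sub>1 * \<xi>\<^sub>2 powi (int N - 2)))"
proof -
  define D where "D = v\<^sub>1 * w\<^sub>2 * \<xi>\<^sub>1 powi (int N - 2) - v\<^sub>2 * w\<^sub>1 * \<xi>\<^sub>2 powi (int N - 2)"
  define d where "d j = ((1 - s\<^sub>0 / s) *
         (w\<^sub>1 * \<xi>\<^sub>2 powi (int N - int j - 1) - w\<^sub>2 * \<xi>\<^sub>1 powi (int N - int j - 1)) +
       (1 - s\<^sub>N / s) * (p / q) powi (int N - 2) *
         (v\<^sub>2 * \<xi>\<^sub>1 powi (1 - int j) - v\<^sub>1 * \<xi>\<^sub>2 powi (1 - int j))) / D" for j :: nat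
  define m where "m j = (1 - s) / s + d j" for j
  have pqs_pos: "p > 0" "q > 0" "s > 0"
    using pqs interior_nonneg by (auto simp: zero_less_mult_iff)
  note roots = quadratic_roots_separated[OF pqs_pos interior_sum \<xi>\<^sub>1 \<xi>\<^sub>2]
  have nz: "\<xi>\<^sub>1 \<noteq> 0" "\<xi>\<^sub>2 \<noteq> 0" using roots(1-3) by auto
  have "0 < D"
    unfolding D_def v\<^sub>1 v\<^sub>2 w\<^sub>1 w\<^sub>2
    by (rule denominator_pos[OF N roots(1-3) left_nonneg(1,3) left_sum nondegenerate(1)
          right_nonneg(1,3) right_sum nondegenerate(2,3)])
  then have "D \<noteq> 0" by simp
  note excess = excess_boundary_problem[OF N nz roots(4,5) v\<^sub>1 v\<^sub>2 w\<^sub>1 w\<^sub>2 D_def \<open>D \<noteq> 0\<close>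
      d_def[unfolded roots(6)]]
  \<comment> \<open>The constant e = (1 - s)/s is lost at rate s' at an end with absorption probability s',
    so that of the inhomogeneity 1 - s' there remains 1 - s'/s for the excess.\<close>
  have shift_end: "e + d\<^sub>0 = p' * (e + d\<^sub>1) + r' * (e + d\<^sub>0) + (1 - s')"
    if "p' + r' + s' = 1" "(1 - r') * d\<^sub>0 = p' * d\<^sub>1 + (1 - s' / s)" and e: "e = (1 - s) / s"
    for p' r' s' d\<^sub>0 d\<^sub>1 e :: real
  proof -
    have "s' * e = s' / s - s'" unfolding e using \<open>s > 0\<close> by (simp add: field_simps)
    then show ?thesis using that(1,2) by algebra
  qed
  let ?K = "pqrs_kernel N p q r s p\<^sub>0 r\<^sub>0 s\<^sub>0 q\<^sub>N r\<^sub>N s\<^sub>N"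
  have "enn2ereal (expected_time_before_absorption M X) = ereal (m i)"
  proof (rule first_step_analysis[OF walk, of "{..N}" m])
    show "?K None y = (if y = None then 1 else 0)" for y
      by (simp add: pqrs_kernel_def)
    fix x assume "x \<in> {..N}"
    then have x: "x \<le> N" by simp
    show "(\<Sum>y\<in>{..N}. ?K (Some x) (Some y)) + ?K (Some x) None = 1"
      using sum_pqrs_kernel[OF N x, of p q r s p\<^sub>0 r\<^sub>0 s\<^sub>0 q\<^sub>N r\<^sub>N s\<^sub>N "\<lambda>_. 1"] N
        interior_sum left_sum right_sum
      by (simp add: pqrs_kernel_def)
    consider "x = 0" | "x = N" "x \<noteq> 0" | k where "x = Suc k" "x < N"
      using x by (cases x) (auto simp: le_less)
    then show "m x = (\<Sum>y\<in>{..N}. ?K (Some x) (Some y) * m y) + (1 - ?K (Some x) None)"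
    proof cases
      case 1
      have "m 0 = p\<^sub>0 * m 1 + r\<^sub>0 * m 0 + (1 - s\<^sub>0)"
        unfolding m_def by (rule shift_end[OF left_sum excess(2) refl])
      then show ?thesis using 1
        unfolding sum_pqrs_kernel[OF N x] by (simp add: pqrs_kernel_def)
    next
      case 2
      have "m N = q\<^sub>N * m (N - 1) + r\<^sub>N * m N + (1 - s\<^sub>N)"
        unfolding m_def by (rule shift_end[OF right_sum excess(3) refl])
      then show ?thesis using 2
        unfolding sum_pqrs_kernel[OF N x] by (simp add: pqrs_kernel_def)
    next
      case (3 k)
      have "s * ((1 - s) / s) = 1 - s" using \<open>s > 0\<close> by simp
      then have "m (Suc k) = p * m (Suc (Suc k)) + q * m k + r * m (Suc k) + (1 - s)"
        unfolding m_def using excess(1)[of k] interior_sum by algebra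
      then show ?thesis using 3
        unfolding sum_pqrs_kernel[OF N x] by (simp add: pqrs_kernel_def)
    qed
  qed (use i in auto)
  then show ?thesis unfolding m_def d_def D_def .
qed

end
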